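(* Let $(X,d)$ be a (not necessarily symmetric) metric space with the convergence-symmetry property. On the set of Cauchy sequences in $X$, declare $(p_n)\sim(q_n)$ if $d(p_n,q_n)\to0$ as $n\to\infty$. Then $\sim$ is an equivalence relation. Let $X^*$ be the set of equivalence classes, and for $P,Q\in X^*$ represented by $(p_n)$, $(q_n)$ put $\Delta(P,Q)=\lim_{n\to\infty}d(p_n,q_n)$. Then the limit exists and is independent of the representatives, and $(X^*,\Delta)$ is a (not necessarily symmetric) metric space that has the convergence-symmetry property and is complete. The map $\phi:X\to X^*$ sending $p$ to the class of the constant sequence $p$ is distance-preserving ($\Delta(\phi(p),\phi(q))=d(p,q)$ for all $p,q\in X$), and $\phi(X)$ is dense in $X^*$. Moreover, if $(X',d')$ is a complete metric space having the convergence-symmetry property and $\phi':X\to X'$ is a distance-preserving map, then $\phi'$ can be extended to a map $X^*\to X'$ (extending $\phi'$ through $\phi$) by sending the element $P$ represented by a Cauchy sequence $(p_n)$ to the unique limit of $(\phi'(p_n))$ in $X'$.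
   Context: A (not necessarily symmetric) metric space is a non-empty set $X$ with $d:X\times X\to[0,\infty)$ such that $d(x,y)=0$ iff $x=y$, and $d(x,y)+d(y,z)\ge d(x,z)$ for all $x,y,z$. It has the convergence-symmetry property if for any two sequences $(p_n)$, $(q_n)$ in $X$ with $d(p_n,q_n)\to0$ one also has $d(q_n,p_n)\to0$ as $n\to\infty$. In such a space, a sequence $(x_n)$ is Cauchy if for every $\epsilon>0$ there is $N$ with $d(x_n,x_m)<\epsilon$ for all $n,m\ge N$; $(x_n)$ converges to $x$ if $d(x_n,x)\to0$ (equivalently $d(x,x_n)\to0$); the space is complete if every Cauchy sequence converges to some point; and a subset $A\subset X$ is dense if each $x\in X$ is the limit of a sequence in $A$. *)

theory Defs
  imports "HOL-Analysis.Analysis"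
begin

locale asym_metric_space =
  fixes X :: "'a set" and d :: "'a \<Rightarrow> 'a \<Rightarrow> real"
  assumes nonempty: "X \<noteq> {}"
    and nonneg: "\<lbrakk>x \<in> X; y \<in> X\<rbrakk> \<Longrightarrow> 0 \<le> d x y"
    and zero_iff: "\<lbrakk>x \<in> X; y \<in> X\<rbrakk> \<Longrightarrow> d x y = 0 \<longleftrightarrow> x = y"
    and triangle: "\<lbrakk>x \<in> X; y \<in> X; z \<in> X\<rbrakk> \<Longrightarrow> d x z \<le> d x y + d y z"

definition convergence_symmetric :: "'a set \<Rightarrow> ('a \<Rightarrow> 'a \<Rightarrow> real) \<Rightarrow> bool" where
  "convergence_symmetric X d \<longleftrightarrow>
     (\<forall>p q :: nat \<Rightarrow> 'a. range p \<subseteq> X \<longrightarrow> range q \<subseteq> X \<longrightarrow>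
        (\<lambda>n. d (p n) (q n)) \<longlonglongrightarrow> 0 \<longrightarrow> (\<lambda>n. d (q n) (p n)) \<longlonglongrightarrow> 0)"

definition asym_Cauchy :: "'a set \<Rightarrow> ('a \<Rightarrow> 'a \<Rightarrow> real) \<Rightarrow> (nat \<Rightarrow> 'a) \<Rightarrow> bool" where
  "asym_Cauchy X d p \<longleftrightarrow>
     range p \<subseteq> X \<and> (\<forall>\<epsilon>>0. \<exists>N. \<forall>n\<ge>N. \<forall>m\<ge>N. d (p n) (p m) < \<epsilon>)"

definition asym_converges :: "'a set \<Rightarrow> ('a \<Rightarrow> 'a \<Rightarrow> real) \<Rightarrow> (nat \<Rightarrow> 'a) \<Rightarrow> 'a \<Rightarrow> bool" where
  "asym_converges X d p x \<longleftrightarrow> range p \<subseteq> X \<and> x \<in> X \<and> (\<lambda>n. d (p n) x) \<longlonglongrightarrow> 0"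

definition asym_complete :: "'a set \<Rightarrow> ('a \<Rightarrow> 'a \<Rightarrow> real) \<Rightarrow> bool" where
  "asym_complete X d \<longleftrightarrow> (\<forall>p. asym_Cauchy X d p \<longrightarrow> (\<exists>x. asym_converges X d p x))"

definition asym_dense :: "'a set \<Rightarrow> ('a \<Rightarrow> 'a \<Rightarrow> real) \<Rightarrow> 'a set \<Rightarrow> bool" where
  "asym_dense X d A \<longleftrightarrow>
     A \<subseteq> X \<and> (\<forall>x\<in>X. \<exists>a. range a \<subseteq> A \<and> asym_converges X d a x)"

definition distance_preserving ::
  "'a set \<Rightarrow> ('a \<Rightarrow> 'a \<Rightarrow> real) \<Rightarrow> 'b set \<Rightarrow> ('b \<Rightarrow> 'b \<Rightarrow> real) \<Rightarrow> ('a \<Rightarrow> 'b) \<Rightarrow> bool" where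
  "distance_preserving X d X' d' f \<longleftrightarrow>
     f \<in> X \<rightarrow> X' \<and> (\<forall>x\<in>X. \<forall>y\<in>X. d' (f x) (f y) = d x y)"

definition Cauchy_seqs :: "'a set \<Rightarrow> ('a \<Rightarrow> 'a \<Rightarrow> real) \<Rightarrow> (nat \<Rightarrow> 'a) set" where
  "Cauchy_seqs X d = {p. asym_Cauchy X d p}"

definition Cauchy_rel ::
  "'a set \<Rightarrow> ('a \<Rightarrow> 'a \<Rightarrow> real) \<Rightarrow> ((nat \<Rightarrow> 'a) \<times> (nat \<Rightarrow> 'a)) set" where
  "Cauchy_rel X d =
     {(p, q). p \<in> Cauchy_seqs X d \<and> q \<in> Cauchy_seqs X d \<and> (\<lambda>n. d (p n) (q n)) \<longlonglongrightarrow> 0}"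

definition asym_completion :: "'a set \<Rightarrow> ('a \<Rightarrow> 'a \<Rightarrow> real) \<Rightarrow> (nat \<Rightarrow> 'a) set set" where
  "asym_completion X d = Cauchy_seqs X d // Cauchy_rel X d"

text \<open>The common limit over all pairs of representatives; that it exists for all points of the
  completion has to be proved.\<close>

definition completion_dist ::
  "('a \<Rightarrow> 'a \<Rightarrow> real) \<Rightarrow> (nat \<Rightarrow> 'a) set \<Rightarrow> (nat \<Rightarrow> 'a) set \<Rightarrow> real" where
  "completion_dist d P Q = (THE L. \<forall>p\<in>P. \<forall>q\<in>Q. (\<lambda>n. d (p n) (q n)) \<longlonglongrightarrow> L)"

definition completion_embed ::
  "'a set \<Rightarrow> ('a \<Rightarrow> 'a \<Rightarrow> real) \<Rightarrow> 'a \<Rightarrow> (nat \<Rightarrow> 'a) set" where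
  "completion_embed X d x = Cauchy_rel X d `` {\<lambda>n. x}"

end

(* The sequential form of convergence symmetry makes the relation on Cauchy sequences symmetric; it
   is equivalent to a uniform condition (for every e there is a delta such that d x y < delta forces
   d y x < e), and that form passes to limits and hence to the completion.  For completeness, each
   term of a Cauchy sequence in the completion is approximated, in both directions, by the image of a
   point of X; these points form a Cauchy sequence in X whose class is the limit. *)

theory Submission
  imports Defs
begin

text \<open>Packaging both hypotheses as a locale allows the lemmas below to be instantiated again,
  for the completion itself and for the target space of an extension.\<close>

locale conv_sym_metric_space = asym_metric_space +
  assumes conv_sym: "convergence_symmetric X d"
begin

section \<open>Convergence symmetry, sequential and uniform\<close>

lemma conv_symD:
  assumes "range p \<subseteq> X" "range q \<subseteq> X" "(\<lambda>n. d (p n) (q n)) \<longlonglongrightarrow> 0"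
  shows "(\<lambda>n. d (q n) (p n)) \<longlonglongrightarrow> 0"
  using conv_sym assms unfolding convergence_symmetric_def by blast

text \<open>If no \<delta> works for \<open>e\<close>, each bound 1/(n+1) is beaten by a pair whose
  reverse distance is still at least \<open>e\<close>. The sequences formed by these pairs
  contradict the sequential condition. This form involves no sequences in \<open>X\<close>, so it
  can be applied termwise to representatives.\<close>

lemma uniform_conv_sym:
  assumes "0 < e"
  obtains \<delta> where "0 < \<delta>" "\<And>x y. \<lbrakk>x \<in> X; y \<in> X; d x y < \<delta>\<rbrakk> \<Longrightarrow> d y x < e"
proof -
  have "\<exists>\<delta>>0. \<forall>x\<in>X. \<forall>y\<in>X. d x y < \<delta> \<longrightarrow> d y x < e"
  proof (rule ccontr)
    assume contr: "\<not> ?thesis"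
    \<comment> \<open>\<open>Suc n\<close> rather than \<open>n\<close>, so that the bound is
      positive also at \<open>n = 0\<close>.\<close>
    have "\<exists>x y. x \<in> X \<and> y \<in> X \<and> d x y < inverse (real (Suc n)) \<and> e \<le> d y x" for n
    proof -
      have "0 < inverse (real (Suc n))" by simp
      with contr show ?thesis by (meson not_le)
    qed
    then obtain p q where pq: "\<And>n. p n \<in> X" "\<And>n. q n \<in> X"
        "\<And>n. d (p n) (q n) < inverse (real (Suc n))" "\<And>n. e \<le> d (q n) (p n)"
      by metis
    have "(\<lambda>n. d (p n) (q n)) \<longlonglongrightarrow> 0"
      by (rule tendsto_sandwich[OF _ _ tendsto_const LIMSEQ_inverse_real_of_nat])
        (use pq in \<open>auto intro!: always_eventually nonneg intro: less_imp_le simp del: of_nat_Suc\<close>)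
    then have "(\<lambda>n. d (q n) (p n)) \<longlonglongrightarrow> 0"
      by (rule conv_symD[rotated 2]) (use pq in auto)
    then have "e \<le> 0"
      by (rule LIMSEQ_le_const) (use pq in auto)
    with assms show False by simp
  qed
  then show ?thesis using that by blast
qed

section \<open>Cauchy sequences and their equivalence\<close>

lemma self_distance_zero: "x \<in> X \<Longrightarrow> d x x = 0"
  using zero_iff[of x x] by simp

lemma Cauchy_seqs_in: "p \<in> Cauchy_seqs X d \<Longrightarrow> p n \<in> X"
  by (auto simp: Cauchy_seqs_def asym_Cauchy_def)

lemma Cauchy_seqs_range: "p \<in> Cauchy_seqs X d \<Longrightarrow> range p \<subseteq> X"
  by (auto simp: Cauchy_seqs_in)

lemma Cauchy_seqsD:
  assumes "p \<in> Cauchy_seqs X d" "0 < e"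
  obtains N where "\<And>n m. \<lbrakk>N \<le> n; N \<le> m\<rbrakk> \<Longrightarrow> d (p n) (p m) < e"
proof -
  have "\<exists>N. \<forall>n\<ge>N. \<forall>m\<ge>N. d (p n) (p m) < e"
    using assms by (simp add: Cauchy_seqs_def asym_Cauchy_def)
  then obtain N where "\<forall>n\<ge>N. \<forall>m\<ge>N. d (p n) (p m) < e" ..
  then show ?thesis by (intro that[of N]) simp
qed

lemma const_Cauchy_seqs: "x \<in> X \<Longrightarrow> (\<lambda>n. x) \<in> Cauchy_seqs X d"
  by (auto simp: Cauchy_seqs_def asym_Cauchy_def self_distance_zero)

lemma tendsto_zero_trans:
  assumes "range p \<subseteq> X" "range q \<subseteq> X" "range r \<subseteq> X"
    and "(\<lambda>n. d (p n) (q n)) \<longlonglongrightarrow> 0" "(\<lambda>n. d (q n) (r n)) \<longlonglongrightarrow> 0"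
  shows "(\<lambda>n. d (p n) (r n)) \<longlonglongrightarrow> 0"
proof (rule tendsto_sandwich[OF _ _ tendsto_const])
  show "(\<lambda>n. d (p n) (q n) + d (q n) (r n)) \<longlonglongrightarrow> 0"
    using tendsto_add[OF assms(4,5)] by simp
qed (use assms(1-3) in \<open>auto intro!: always_eventually nonneg triangle simp: image_subset_iff\<close>)

text \<open>Reflexivity comes from zero self-distance and transitivity from the triangle inequality;
  symmetry is exactly where convergence symmetry enters.\<close>

lemma equiv_Cauchy_rel: "equiv (Cauchy_seqs X d) (Cauchy_rel X d)"
proof (rule equivI)
  show "Cauchy_rel X d \<subseteq> Cauchy_seqs X d \<times> Cauchy_seqs X d"
    by (auto simp: Cauchy_rel_def)
  show "refl_on (Cauchy_seqs X d) (Cauchy_rel X d)"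
    by (auto simp: refl_on_def Cauchy_rel_def Cauchy_seqs_in self_distance_zero)
  show "sym (Cauchy_rel X d)"
  proof (rule symI)
    fix p q assume "(p, q) \<in> Cauchy_rel X d"
    then have p: "p \<in> Cauchy_seqs X d" and q: "q \<in> Cauchy_seqs X d"
      and lim: "(\<lambda>n. d (p n) (q n)) \<longlonglongrightarrow> 0"
      by (auto simp: Cauchy_rel_def)
    have "(\<lambda>n. d (q n) (p n)) \<longlonglongrightarrow> 0"
      by (rule conv_symD[OF Cauchy_seqs_range[OF p] Cauchy_seqs_range[OF q] lim])
    with p q show "(q, p) \<in> Cauchy_rel X d" by (simp add: Cauchy_rel_def)
  qed
  show "trans (Cauchy_rel X d)"
  proof (rule transI)
    fix p q r assume "(p, q) \<in> Cauchy_rel X d" "(q, r) \<in> Cauchy_rel X d"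
    then have p: "p \<in> Cauchy_seqs X d" and q: "q \<in> Cauchy_seqs X d" and r: "r \<in> Cauchy_seqs X d"
      and lim: "(\<lambda>n. d (p n) (q n)) \<longlonglongrightarrow> 0" "(\<lambda>n. d (q n) (r n)) \<longlonglongrightarrow> 0"
      by (auto simp: Cauchy_rel_def)
    have "(\<lambda>n. d (p n) (r n)) \<longlonglongrightarrow> 0"
      by (rule tendsto_zero_trans[OF Cauchy_seqs_range[OF p] Cauchy_seqs_range[OF q]
            Cauchy_seqs_range[OF r] lim])
    with p r show "(p, r) \<in> Cauchy_rel X d" by (simp add: Cauchy_rel_def)
  qed
qed

text \<open>The detour through \<open>p m\<close> and \<open>q m\<close> bounds the change of the
  distance by \<open>d (p n) (p m) + d (q m) (q n)\<close>. The indices occur in opposite orders,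
  and the Cauchy condition covers both. Completeness of the reals then supplies the limit.\<close>

lemma convergent_dist:
  assumes p: "p \<in> Cauchy_seqs X d" and q: "q \<in> Cauchy_seqs X d"
  shows "convergent (\<lambda>n. d (p n) (q n))"
proof -
  have "Cauchy (\<lambda>n. d (p n) (q n))"
  proof (rule metric_CauchyI)
    fix e :: real assume "0 < e"
    then have e: "0 < e / 2" by simp
    obtain M where M: "\<And>n m. \<lbrakk>M \<le> n; M \<le> m\<rbrakk> \<Longrightarrow> d (p n) (p m) < e / 2"
      using Cauchy_seqsD[OF p e] by blast
    obtain N where N: "\<And>n m. \<lbrakk>N \<le> n; N \<le> m\<rbrakk> \<Longrightarrow> d (q n) (q m) < e / 2"
      using Cauchy_seqsD[OF q e] by blast
    \<comment> \<open>A one-sided bound is enough: exchanging \<open>n\<close> and \<open>m\<close>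
      gives the other half of the absolute value.\<close>
    have *: "d (p n) (q n) - d (p m) (q m) < e" if "max M N \<le> n" "max M N \<le> m" for n m
    proof -
      have "d (p n) (q n) \<le> d (p n) (p m) + d (p m) (q n)"
        by (intro triangle Cauchy_seqs_in p q)
      moreover have "d (p m) (q n) \<le> d (p m) (q m) + d (q m) (q n)"
        by (intro triangle Cauchy_seqs_in p q)
      ultimately show ?thesis using M[of n m] N[of m n] that by simp
    qed
    then show "\<exists>K. \<forall>m\<ge>K. \<forall>n\<ge>K. dist (d (p m) (q m)) (d (p n) (q n)) < e"
      unfolding dist_real_def abs_less_iff by (intro exI[of _ "max M N"]) force
  qed
  then show ?thesis by (rule Cauchy_convergent)
qed

text \<open>A squeeze by two four-point triangle inequalities. Each bound uses one given null
  sequence and one reversed one: \<open>d (q' n) (q n)\<close> below and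
  \<open>d (p' n) (p n)\<close> above. Convergence symmetry provides the reversed ones.\<close>

lemma tendsto_dist_cong:
  assumes p: "(p, p') \<in> Cauchy_rel X d" and q: "(q, q') \<in> Cauchy_rel X d"
    and L: "(\<lambda>n. d (p n) (q n)) \<longlonglongrightarrow> L"
  shows "(\<lambda>n. d (p' n) (q' n)) \<longlonglongrightarrow> L"
proof -
  have C: "p \<in> Cauchy_seqs X d" "p' \<in> Cauchy_seqs X d" "q \<in> Cauchy_seqs X d" "q' \<in> Cauchy_seqs X d"
    and lim: "(\<lambda>n. d (p n) (p' n)) \<longlonglongrightarrow> 0" "(\<lambda>n. d (q n) (q' n)) \<longlonglongrightarrow> 0"
    using p q by (auto simp: Cauchy_rel_def)
  have lim': "(\<lambda>n. d (p' n) (p n)) \<longlonglongrightarrow> 0" "(\<lambda>n. d (q' n) (q n)) \<longlonglongrightarrow> 0"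
    by (rule conv_symD; intro Cauchy_seqs_range C lim)+
  have tri: "d x w \<le> d x y + d y z + d z w" if "x \<in> X" "y \<in> X" "z \<in> X" "w \<in> X" for x y z w
    using triangle[of x y w] triangle[of y z w] that by linarith
  show ?thesis
  proof (rule tendsto_sandwich)
    show "(\<lambda>n. d (p n) (q n) - d (p n) (p' n) - d (q' n) (q n)) \<longlonglongrightarrow> L"
      using tendsto_diff[OF tendsto_diff[OF L lim(1)] lim'(2)] by simp
    show "(\<lambda>n. d (p' n) (p n) + d (p n) (q n) + d (q n) (q' n)) \<longlonglongrightarrow> L"
      using tendsto_add[OF tendsto_add[OF lim'(1) L] lim(2)] by simp
    show "\<forall>\<^sub>F n in sequentially. d (p n) (q n) - d (p n) (p' n) - d (q' n) (q n) \<le> d (p' n) (q' n)"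
    proof (intro always_eventually allI)
      fix n
      show "d (p n) (q n) - d (p n) (p' n) - d (q' n) (q n) \<le> d (p' n) (q' n)"
        using tri[of "p n" "p' n" "q' n" "q n"] C by (simp add: Cauchy_seqs_in)
    qed
    show "\<forall>\<^sub>F n in sequentially. d (p' n) (q' n) \<le> d (p' n) (p n) + d (p n) (q n) + d (q n) (q' n)"
      by (intro always_eventually allI tri Cauchy_seqs_in C)
  qed
qed

section \<open>Representatives and the distance on the completion\<close>

abbreviation cls :: "(nat \<Rightarrow> 'a) \<Rightarrow> (nat \<Rightarrow> 'a) set" where
  "cls p \<equiv> Cauchy_rel X d `` {p}"

abbreviation \<Delta> :: "(nat \<Rightarrow> 'a) set \<Rightarrow> (nat \<Rightarrow> 'a) set \<Rightarrow> real" where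
  "\<Delta> \<equiv> completion_dist d"

abbreviation Xc :: "(nat \<Rightarrow> 'a) set set" where
  "Xc \<equiv> asym_completion X d"

lemma cls_in_completion: "p \<in> Cauchy_seqs X d \<Longrightarrow> cls p \<in> Xc"
  unfolding asym_completion_def by (rule quotientI)

lemma self_in_cls: "p \<in> Cauchy_seqs X d \<Longrightarrow> p \<in> cls p"
  using equiv_Cauchy_rel by (rule equiv_class_self)

lemma completion_rep:
  assumes "P \<in> Xc" "p \<in> P"
  shows "p \<in> Cauchy_seqs X d" "P = cls p"
proof -
  obtain r where "P = cls r"
    using assms(1) unfolding asym_completion_def by (auto elim: quotientE)
  with assms(2) have "(r, p) \<in> Cauchy_rel X d" by simp
  then show "p \<in> Cauchy_seqs X d" "P = cls p"
    using equiv_class_eq[OF equiv_Cauchy_rel] \<open>P = cls r\<close> by (auto simp: Cauchy_rel_def)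
qed

lemma completion_cases:
  assumes "P \<in> Xc"
  obtains p where "p \<in> Cauchy_seqs X d" "P = cls p"
  using assms unfolding asym_completion_def by (auto elim: quotientE)

text \<open>This justifies the definite description in \<open>completion_dist\<close>: one pair of
  representatives has a limit, \<open>tendsto_dist_cong\<close> carries it to all pairs, and it is
  unique because \<open>p\<close> and \<open>q\<close> belong to their own classes.\<close>

lemma tendsto_completion_dist:
  assumes p: "p \<in> Cauchy_seqs X d" and q: "q \<in> Cauchy_seqs X d"
  shows "(\<lambda>n. d (p n) (q n)) \<longlonglongrightarrow> \<Delta> (cls p) (cls q)"
proof -
  obtain L where L: "(\<lambda>n. d (p n) (q n)) \<longlonglongrightarrow> L"
    using convergent_dist[OF p q] unfolding convergent_def by blast
  have "\<Delta> (cls p) (cls q) = L"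
    unfolding completion_dist_def
  proof (rule the_equality)
    show "\<forall>p'\<in>cls p. \<forall>q'\<in>cls q. (\<lambda>n. d (p' n) (q' n)) \<longlonglongrightarrow> L"
      using tendsto_dist_cong[OF _ _ L] by blast
    show "M = L" if "\<forall>p'\<in>cls p. \<forall>q'\<in>cls q. (\<lambda>n. d (p' n) (q' n)) \<longlonglongrightarrow> M" for M
      using that self_in_cls[OF p] self_in_cls[OF q] L LIMSEQ_unique by blast
  qed
  with L show ?thesis by simp
qed

lemma tendsto_completion_dist_rep:
  assumes "P \<in> Xc" "Q \<in> Xc" "p \<in> P" "q \<in> Q"
  shows "(\<lambda>n. d (p n) (q n)) \<longlonglongrightarrow> \<Delta> P Q"
  using tendsto_completion_dist[of p q] completion_rep[OF assms(1,3)] completion_rep[OF assms(2,4)]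
  by simp

section \<open>Metric axioms and convergence symmetry of the completion\<close>

lemma asym_metric_completion: "asym_metric_space Xc \<Delta>"
proof
  obtain x where "x \<in> X" using nonempty by blast
  then show "Xc \<noteq> {}"
    using cls_in_completion[OF const_Cauchy_seqs] by blast
next
  fix P Q assume P: "P \<in> Xc" and Q: "Q \<in> Xc"
  obtain p where p: "p \<in> Cauchy_seqs X d" "P = cls p"
    using P by (rule completion_cases)
  obtain q where q: "q \<in> Cauchy_seqs X d" "Q = cls q"
    using Q by (rule completion_cases)
  note lim = tendsto_completion_dist[OF p(1) q(1), folded p(2) q(2)]
  show "0 \<le> \<Delta> P Q"
    by (rule LIMSEQ_le_const[OF lim]) (use p q in \<open>auto intro: nonneg Cauchy_seqs_in\<close>)
  \<comment> \<open>By uniqueness of limits, distance zero is precisely the defining condition of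
    \<open>Cauchy_rel\<close>.\<close>
  have "\<Delta> P Q = 0 \<longleftrightarrow> (p, q) \<in> Cauchy_rel X d"
    using lim p(1) q(1) by (auto simp: Cauchy_rel_def dest: LIMSEQ_unique)
  also have "\<dots> \<longleftrightarrow> P = Q"
    using eq_equiv_class_iff[OF equiv_Cauchy_rel p(1) q(1)] p(2) q(2) by simp
  finally show "\<Delta> P Q = 0 \<longleftrightarrow> P = Q" .
next
  fix P Q R assume P: "P \<in> Xc" and Q: "Q \<in> Xc" and R: "R \<in> Xc"
  obtain p where p: "p \<in> Cauchy_seqs X d" "P = cls p"
    using P by (rule completion_cases)
  obtain q where q: "q \<in> Cauchy_seqs X d" "Q = cls q"
    using Q by (rule completion_cases)
  obtain r where r: "r \<in> Cauchy_seqs X d" "R = cls r"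
    using R by (rule completion_cases)
  show "\<Delta> P R \<le> \<Delta> P Q + \<Delta> Q R"
    unfolding p(2) q(2) r(2)
    by (rule LIMSEQ_le[OF tendsto_completion_dist[OF p(1) r(1)]
          tendsto_add[OF tendsto_completion_dist[OF p(1) q(1)] tendsto_completion_dist[OF q(1) r(1)]]])
      (use p q r in \<open>auto intro: triangle Cauchy_seqs_in\<close>)
qed

text \<open>The uniform form survives limits: if \<open>\<Delta> A B < \<delta>\<close>,
  representatives are eventually closer than \<delta>, so their reverse distances are eventually
  below \<open>e / 2\<close>. In the limit this is only a weak inequality, and the halving restores
  strictness.\<close>

lemma convergence_symmetric_completion: "convergence_symmetric Xc \<Delta>"
  unfolding convergence_symmetric_def
proof (intro allI impI)
  fix P Q :: "nat \<Rightarrow> (nat \<Rightarrow> 'a) set"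
  assume P: "range P \<subseteq> Xc" and Q: "range Q \<subseteq> Xc" and lim: "(\<lambda>n. \<Delta> (P n) (Q n)) \<longlonglongrightarrow> 0"
  interpret C: asym_metric_space Xc \<Delta> by (rule asym_metric_completion)
  have in_Xc: "P n \<in> Xc" "Q n \<in> Xc" for n using P Q by auto
  show "(\<lambda>n. \<Delta> (Q n) (P n)) \<longlonglongrightarrow> 0"
  proof (rule order_tendstoI)
    fix a :: real assume "a < 0"
    then show "\<forall>\<^sub>F n in sequentially. a < \<Delta> (Q n) (P n)"
      using less_le_trans[OF _ C.nonneg[OF in_Xc(2) in_Xc(1)]] by simp
  next
    fix e :: real assume "0 < e"
    then have "0 < e / 2" by simp
    then obtain \<delta> where \<delta>: "0 < \<delta>" "\<And>x y. \<lbrakk>x \<in> X; y \<in> X; d x y < \<delta>\<rbrakk> \<Longrightarrow> d y x < e / 2"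
      using uniform_conv_sym by blast
    have *: "\<Delta> B A < e" if AB: "A \<in> Xc" "B \<in> Xc" "\<Delta> A B < \<delta>" for A B
    proof -
      obtain a where a: "a \<in> Cauchy_seqs X d" "A = cls a"
        using AB(1) by (rule completion_cases)
      obtain b where b: "b \<in> Cauchy_seqs X d" "B = cls b"
        using AB(2) by (rule completion_cases)
      have "\<forall>\<^sub>F n in sequentially. d (a n) (b n) < \<delta>"
        using order_tendstoD(2)[OF tendsto_completion_dist[OF a(1) b(1)]] AB(3) a(2) b(2) by simp
      then have "\<forall>\<^sub>F n in sequentially. d (b n) (a n) \<le> e / 2"
        by eventually_elim (use \<delta>(2) a b in \<open>simp add: Cauchy_seqs_in less_imp_le\<close>)
      then have "\<Delta> B A \<le> e / 2"
        unfolding a(2) b(2)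
        by (rule tendsto_upperbound[OF tendsto_completion_dist[OF b(1) a(1)]]) simp
      with \<open>0 < e\<close> show ?thesis by simp
    qed
    show "\<forall>\<^sub>F n in sequentially. \<Delta> (Q n) (P n) < e"
      using order_tendstoD(2)[OF lim \<delta>(1)] by eventually_elim (use * in_Xc in blast)
  qed
qed

section \<open>The embedding, approximation by its image, and density\<close>

lemma embed_in_completion: "x \<in> X \<Longrightarrow> completion_embed X d x \<in> Xc"
  unfolding completion_embed_def by (intro cls_in_completion const_Cauchy_seqs)

lemma dist_embed:
  assumes "x \<in> X" "y \<in> X"
  shows "\<Delta> (completion_embed X d x) (completion_embed X d y) = d x y"
  using tendsto_completion_dist[OF const_Cauchy_seqs[OF assms(1)] const_Cauchy_seqs[OF assms(2)]]
  unfolding completion_embed_def by (simp add: LIMSEQ_const_iff)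

lemma distance_preserving_embed: "distance_preserving X d Xc \<Delta> (completion_embed X d)"
  by (simp add: distance_preserving_def embed_in_completion dist_embed)

text \<open>Let \<open>n\<close> tend to infinity in \<open>d (p n) (p k) < e\<close> and in
  \<open>d (p k) (p n) < e\<close>; strictness is lost in the limit. The tail index \<open>N\<close>
  is kept explicit so that the bound serves every later \<open>k\<close>, as convergence of the
  embedded terms requires.\<close>

lemma dist_cls_embed_le:
  assumes p: "p \<in> Cauchy_seqs X d" and N: "\<And>n m. \<lbrakk>N \<le> n; N \<le> m\<rbrakk> \<Longrightarrow> d (p n) (p m) < e"
    and k: "N \<le> k"
  shows "\<Delta> (cls p) (completion_embed X d (p k)) \<le> e" "\<Delta> (completion_embed X d (p k)) (cls p) \<le> e"
proof -
  note c = const_Cauchy_seqs[OF Cauchy_seqs_in[OF p, of k]]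
  show "\<Delta> (cls p) (completion_embed X d (p k)) \<le> e"
    unfolding completion_embed_def
    by (rule LIMSEQ_le_const2[OF tendsto_completion_dist[OF p c]])
      (use N k in \<open>blast intro: less_imp_le\<close>)
  show "\<Delta> (completion_embed X d (p k)) (cls p) \<le> e"
    unfolding completion_embed_def
    by (rule LIMSEQ_le_const2[OF tendsto_completion_dist[OF c p]])
      (use N k in \<open>blast intro: less_imp_le\<close>)
qed

lemma embed_approx:
  assumes "P \<in> Xc" "0 < e"
  obtains x where "x \<in> X" "\<Delta> P (completion_embed X d x) \<le> e" "\<Delta> (completion_embed X d x) P \<le> e"
proof -
  obtain p where p: "p \<in> Cauchy_seqs X d" "P = cls p"
    using assms(1) by (rule completion_cases)
  obtain N where "\<And>n m. \<lbrakk>N \<le> n; N \<le> m\<rbrakk> \<Longrightarrow> d (p n) (p m) < e"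
    using Cauchy_seqsD[OF p(1) assms(2)] by blast
  from dist_cls_embed_le[OF p(1) this order_refl] show ?thesis
    using that[of "p N"] p Cauchy_seqs_in by blast
qed

lemma embed_approx_seq:
  assumes "range P \<subseteq> Xc"
  obtains x where "\<And>n. x n \<in> X"
    "(\<lambda>n. \<Delta> (P n) (completion_embed X d (x n))) \<longlonglongrightarrow> 0"
    "(\<lambda>n. \<Delta> (completion_embed X d (x n)) (P n)) \<longlonglongrightarrow> 0"
proof -
  interpret C: asym_metric_space Xc \<Delta> by (rule asym_metric_completion)
  have in_Xc: "P n \<in> Xc" for n using assms by auto
  have "\<exists>x. x \<in> X \<and> \<Delta> (P n) (completion_embed X d x) \<le> inverse (real (Suc n)) \<and>
      \<Delta> (completion_embed X d x) (P n) \<le> inverse (real (Suc n))" for n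
    using embed_approx[OF in_Xc[of n], of "inverse (real (Suc n))"]
    by (metis inverse_positive_iff_positive of_nat_0_less_iff zero_less_Suc)
  then obtain x where x: "\<And>n. x n \<in> X"
    "\<And>n. \<Delta> (P n) (completion_embed X d (x n)) \<le> inverse (real (Suc n))"
    "\<And>n. \<Delta> (completion_embed X d (x n)) (P n) \<le> inverse (real (Suc n))"
    by metis
  show ?thesis
  proof (rule that[OF x(1)])
    show "(\<lambda>n. \<Delta> (P n) (completion_embed X d (x n))) \<longlonglongrightarrow> 0"
      by (rule tendsto_sandwich[OF _ _ tendsto_const LIMSEQ_inverse_real_of_nat])
        (intro always_eventually allI C.nonneg in_Xc embed_in_completion x)+
    show "(\<lambda>n. \<Delta> (completion_embed X d (x n)) (P n)) \<longlonglongrightarrow> 0"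
      by (rule tendsto_sandwich[OF _ _ tendsto_const LIMSEQ_inverse_real_of_nat])
        (intro always_eventually allI C.nonneg in_Xc embed_in_completion x)+
  qed
qed

lemma dense_embed: "asym_dense Xc \<Delta> (completion_embed X d ` X)"
  unfolding asym_dense_def asym_converges_def
proof (intro conjI ballI)
  show "completion_embed X d ` X \<subseteq> Xc" by (auto intro: embed_in_completion)
  fix P assume P: "P \<in> Xc"
  \<comment> \<open>The approximating sequence for the constant sequence \<open>P\<close> converges
    to \<open>P\<close> itself.\<close>
  then obtain x where "\<And>n. x n \<in> X" "(\<lambda>n. \<Delta> (completion_embed X d (x n)) P) \<longlonglongrightarrow> 0"
    using embed_approx_seq[of "\<lambda>n. P"] by blast
  with P show "\<exists>a. range a \<subseteq> completion_embed X d ` X \<and>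
      range a \<subseteq> Xc \<and> P \<in> Xc \<and> (\<lambda>n. \<Delta> (a n) P) \<longlonglongrightarrow> 0"
    by (intro exI[of _ "\<lambda>n. completion_embed X d (x n)"]) (auto intro: embed_in_completion)
qed

section \<open>Completeness of the completion\<close>

lemma tendsto_embed_cls:
  assumes "p \<in> Cauchy_seqs X d"
  shows "(\<lambda>n. \<Delta> (completion_embed X d (p n)) (cls p)) \<longlonglongrightarrow> 0"
proof (rule order_tendstoI)
  interpret C: asym_metric_space Xc \<Delta> by (rule asym_metric_completion)
  fix a :: real assume "a < 0"
  then show "\<forall>\<^sub>F n in sequentially. a < \<Delta> (completion_embed X d (p n)) (cls p)"
    using less_le_trans[OF _ C.nonneg[OF embed_in_completion[OF Cauchy_seqs_in[OF assms]]
          cls_in_completion[OF assms]]] by simp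
next
  fix e :: real assume "0 < e"
  then have "0 < e / 2" by simp
  then obtain N where "\<And>n m. \<lbrakk>N \<le> n; N \<le> m\<rbrakk> \<Longrightarrow> d (p n) (p m) < e / 2"
    using Cauchy_seqsD[OF assms] by blast
  from dist_cls_embed_le(2)[OF assms this]
  have "\<Delta> (completion_embed X d (p n)) (cls p) < e" if "N \<le> n" for n
    using that \<open>0 < e\<close> by fastforce
  then show "\<forall>\<^sub>F n in sequentially. \<Delta> (completion_embed X d (p n)) (cls p) < e"
    unfolding eventually_sequentially by blast
qed

lemma complete_completion: "asym_complete Xc \<Delta>"
  unfolding asym_complete_def
proof (intro allI impI)
  fix P assume "asym_Cauchy Xc \<Delta> P"
  then have P: "range P \<subseteq> Xc" and P_Cauchy: "\<And>e. 0 < e \<Longrightarrow> \<exists>N. \<forall>n\<ge>N. \<forall>m\<ge>N. \<Delta> (P n) (P m) < e"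
    by (auto simp: asym_Cauchy_def)
  interpret C: conv_sym_metric_space Xc \<Delta>
    by (intro conv_sym_metric_space.intro asym_metric_completion
        conv_sym_metric_space_axioms.intro convergence_symmetric_completion)
  have in_Xc: "P n \<in> Xc" for n using P by auto
  obtain x where x: "\<And>n. x n \<in> X"
    and Px: "(\<lambda>n. \<Delta> (P n) (completion_embed X d (x n))) \<longlonglongrightarrow> 0"
    and xP: "(\<lambda>n. \<Delta> (completion_embed X d (x n)) (P n)) \<longlonglongrightarrow> 0"
    using embed_approx_seq[OF P] by blast
  have x_Cauchy: "x \<in> Cauchy_seqs X d"
    unfolding Cauchy_seqs_def asym_Cauchy_def mem_Collect_eq
  proof (intro conjI allI impI)
    show "range x \<subseteq> X" using x by auto
    fix e :: real assume "0 < e"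
    then have e: "0 < e / 3" by simp
    obtain K where K: "\<And>n. K \<le> n \<Longrightarrow> \<Delta> (P n) (completion_embed X d (x n)) < e / 3"
      using order_tendstoD(2)[OF Px e] unfolding eventually_sequentially by blast
    obtain L where L: "\<And>n. L \<le> n \<Longrightarrow> \<Delta> (completion_embed X d (x n)) (P n) < e / 3"
      using order_tendstoD(2)[OF xP e] unfolding eventually_sequentially by blast
    obtain M where M: "\<And>n m. \<lbrakk>M \<le> n; M \<le> m\<rbrakk> \<Longrightarrow> \<Delta> (P n) (P m) < e / 3"
      using P_Cauchy[OF e] by blast
    \<comment> \<open>The path runs from \<open>x n\<close> to \<open>P n\<close>, on to
      \<open>P m\<close>, and back to \<open>x m\<close>. Its first leg uses \<open>xP\<close> and
      its last uses \<open>Px\<close>, hence the approximation in both directions.\<close>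
    have "d (x n) (x m) < e" if "max K (max L M) \<le> n" "max K (max L M) \<le> m" for n m
    proof -
      let ?\<phi> = "completion_embed X d"
      have "d (x n) (x m) = \<Delta> (?\<phi> (x n)) (?\<phi> (x m))" by (simp add: dist_embed x)
      also have "\<dots> \<le> \<Delta> (?\<phi> (x n)) (P n) + \<Delta> (P n) (?\<phi> (x m))"
        by (intro C.triangle embed_in_completion x in_Xc)
      also have "\<Delta> (P n) (?\<phi> (x m)) \<le> \<Delta> (P n) (P m) + \<Delta> (P m) (?\<phi> (x m))"
        by (intro C.triangle embed_in_completion x in_Xc)
      finally show ?thesis using K[of m] L[of n] M[of n m] that by simp
    qed
    then show "\<exists>N. \<forall>n\<ge>N. \<forall>m\<ge>N. d (x n) (x m) < e" by blast
  qed
  \<comment> \<open>The class of \<open>x\<close> is the limit: \<open>P n\<close> is close to the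
    image of \<open>x n\<close>, and these images converge to the class.\<close>
  have "(\<lambda>n. \<Delta> (P n) (cls x)) \<longlonglongrightarrow> 0"
    by (rule C.tendsto_zero_trans[OF _ _ _ Px tendsto_embed_cls[OF x_Cauchy]])
      (use P x cls_in_completion[OF x_Cauchy] in \<open>auto intro: embed_in_completion\<close>)
  then show "\<exists>Q. asym_converges Xc \<Delta> P Q"
    unfolding asym_converges_def using P cls_in_completion[OF x_Cauchy] by blast
qed

section \<open>Uniqueness of limits and extension of maps\<close>

lemma asym_converges_unique:
  assumes "asym_converges X d p x" "asym_converges X d p y"
  shows "x = y"
proof -
  have X: "range p \<subseteq> X" "x \<in> X" "y \<in> X"
    and lim: "(\<lambda>n. d (p n) x) \<longlonglongrightarrow> 0" "(\<lambda>n. d (p n) y) \<longlonglongrightarrow> 0"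
    using assms by (auto simp: asym_converges_def)
  \<comment> \<open>The triangle inequality from \<open>x\<close> through \<open>p n\<close> to
    \<open>y\<close> needs the distance out of \<open>x\<close>, the reverse of the one
    given.\<close>
  have lim': "(\<lambda>n. d x (p n)) \<longlonglongrightarrow> 0"
    by (rule conv_symD[of p "\<lambda>n. x"]) (use X lim(1) in auto)
  have "(\<lambda>n::nat. d x y) \<longlonglongrightarrow> 0"
    by (rule tendsto_zero_trans[of "\<lambda>n. x" p "\<lambda>n. y"]) (use X lim' lim(2) in auto)
  then show ?thesis using X zero_iff by (simp add: LIMSEQ_const_iff)
qed

lemma asym_converges_const: "x \<in> X \<Longrightarrow> asym_converges X d (\<lambda>n. x) x"
  by (auto simp: asym_converges_def self_distance_zero)

text \<open>A distance-preserving map sends Cauchy sequences to Cauchy sequences, which converge in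
  the complete target. Equivalent sequences have images with the same limit, so each class
  determines one value.\<close>

lemma extension_exists:
  fixes X' :: "'b set"
  assumes "conv_sym_metric_space X' d'" and complete: "asym_complete X' d'"
    and \<phi>': "distance_preserving X d X' d' \<phi>'"
  shows "\<exists>\<psi> \<in> Xc \<rightarrow> X'.
    (\<forall>x\<in>X. \<psi> (completion_embed X d x) = \<phi>' x) \<and>
    (\<forall>P \<in> Xc. \<forall>p\<in>P. asym_converges X' d' (\<lambda>n. \<phi>' (p n)) (\<psi> P) \<and>
      (\<exists>!y. asym_converges X' d' (\<lambda>n. \<phi>' (p n)) y))"
proof -
  interpret Y: conv_sym_metric_space X' d' by fact
  have \<phi>'_in: "\<phi>' x \<in> X'" if "x \<in> X" for x
    using \<phi>' that by (auto simp: distance_preserving_def)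
  have \<phi>'_dist: "d' (\<phi>' x) (\<phi>' y) = d x y" if "x \<in> X" "y \<in> X" for x y
    using \<phi>' that by (auto simp: distance_preserving_def)
  have ex: "\<exists>y. asym_converges X' d' (\<lambda>n. \<phi>' (p n)) y" if "p \<in> Cauchy_seqs X d" for p
  proof -
    have "asym_Cauchy X' d' (\<lambda>n. \<phi>' (p n))"
      using that Cauchy_seqs_in[OF that]
      by (auto simp: Cauchy_seqs_def asym_Cauchy_def \<phi>'_in \<phi>'_dist)
    then show ?thesis using complete by (auto simp: asym_complete_def)
  qed
  \<comment> \<open>The estimate goes from the image of \<open>q n\<close> through that of
    \<open>p n\<close> to \<open>y\<close>, so the null sequence relating \<open>p\<close> to
    \<open>q\<close> is first reversed in \<open>X\<close> and then transported by
    \<open>\<phi>'\<close>.\<close>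
  have cong: "asym_converges X' d' (\<lambda>n. \<phi>' (q n)) y"
    if pq: "(p, q) \<in> Cauchy_rel X d" and y: "asym_converges X' d' (\<lambda>n. \<phi>' (p n)) y" for p q y
  proof -
    have p: "p \<in> Cauchy_seqs X d" and q: "q \<in> Cauchy_seqs X d" and lim: "(\<lambda>n. d (p n) (q n)) \<longlonglongrightarrow> 0"
      using pq by (auto simp: Cauchy_rel_def)
    have "(\<lambda>n. d (q n) (p n)) \<longlonglongrightarrow> 0"
      by (rule conv_symD[OF Cauchy_seqs_range[OF p] Cauchy_seqs_range[OF q] lim])
    then have "(\<lambda>n. d' (\<phi>' (q n)) (\<phi>' (p n))) \<longlonglongrightarrow> 0"
      by (simp add: \<phi>'_dist Cauchy_seqs_in p q)
    then have "(\<lambda>n. d' (\<phi>' (q n)) y) \<longlonglongrightarrow> 0"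
      by (rule Y.tendsto_zero_trans[rotated 3])
        (use y Cauchy_seqs_in[OF q] \<phi>'_in in \<open>auto simp: asym_converges_def\<close>)
    then show ?thesis
      using y Cauchy_seqs_in[OF q] \<phi>'_in by (auto simp: asym_converges_def)
  qed
  have "\<exists>y. \<forall>p\<in>P. asym_converges X' d' (\<lambda>n. \<phi>' (p n)) y" if "P \<in> Xc" for P
  proof -
    obtain p where p: "p \<in> Cauchy_seqs X d" "P = cls p"
      using \<open>P \<in> Xc\<close> by (rule completion_cases)
    then show ?thesis using ex[OF p(1)] cong by blast
  qed
  \<comment> \<open>Choice of one common limit per class; values outside the completion are
    unconstrained.\<close>
  then obtain \<psi> where \<psi>: "\<And>P p. \<lbrakk>P \<in> Xc; p \<in> P\<rbrakk> \<Longrightarrow> asym_converges X' d' (\<lambda>n. \<phi>' (p n)) (\<psi> P)"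
    by metis
  show ?thesis
  proof (intro bexI[of _ \<psi>] conjI ballI)
    show "\<psi> \<in> Xc \<rightarrow> X'"
    proof
      fix P assume P: "P \<in> Xc"
      then obtain p where "p \<in> P" by (rule completion_cases) (use self_in_cls in blast)
      with \<psi>[OF P] show "\<psi> P \<in> X'" by (auto simp: asym_converges_def)
    qed
    show "\<psi> (completion_embed X d x) = \<phi>' x" if x: "x \<in> X" for x
    \<comment> \<open>The constant sequence \<open>x\<close> represents its embedded class, so both
      values are limits of the constant sequence \<open>\<phi>' x\<close>.\<close>
    proof (rule Y.asym_converges_unique)
      show "asym_converges X' d' (\<lambda>n. \<phi>' x) (\<psi> (completion_embed X d x))"
        using \<psi>[OF embed_in_completion[OF x]] self_in_cls[OF const_Cauchy_seqs[OF x]]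
        unfolding completion_embed_def by blast
      show "asym_converges X' d' (\<lambda>n. \<phi>' x) (\<phi>' x)"
        by (intro Y.asym_converges_const \<phi>'_in x)
    qed
    fix P p assume "P \<in> Xc" "p \<in> P"
    then show "asym_converges X' d' (\<lambda>n. \<phi>' (p n)) (\<psi> P)" by (rule \<psi>)
    then show "\<exists>!y. asym_converges X' d' (\<lambda>n. \<phi>' (p n)) y"
      using Y.asym_converges_unique by blast
  qed
qed

end

theorem mainTheorem12:
  fixes X :: "'a set" and d :: "'a \<Rightarrow> 'a \<Rightarrow> real"
  assumes "asym_metric_space X d" and "convergence_symmetric X d"
  shows "equiv (Cauchy_seqs X d) (Cauchy_rel X d) \<and>
         (\<forall>P \<in> asym_completion X d. \<forall>Q \<in> asym_completion X d. \<forall>p\<in>P. \<forall>q\<in>Q.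
           (\<lambda>n. d (p n) (q n)) \<longlonglongrightarrow> completion_dist d P Q) \<and>
         asym_metric_space (asym_completion X d) (completion_dist d) \<and>
         convergence_symmetric (asym_completion X d) (completion_dist d) \<and>
         asym_complete (asym_completion X d) (completion_dist d) \<and>
         distance_preserving X d (asym_completion X d) (completion_dist d) (completion_embed X d) \<and>
         asym_dense (asym_completion X d) (completion_dist d) (completion_embed X d ` X) \<and>
         (\<forall>(X' :: 'b set) d' \<phi>'.
           asym_metric_space X' d' \<longrightarrow> convergence_symmetric X' d' \<longrightarrow> asym_complete X' d' \<longrightarrow>
           distance_preserving X d X' d' \<phi>' \<longrightarrow>
           (\<exists>\<psi> \<in> asym_completion X d \<rightarrow> X'.
              (\<forall>x\<in>X. \<psi> (completion_embed X d x) = \<phi>' x) \<and>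
              (\<forall>P \<in> asym_completion X d. \<forall>p\<in>P.
                 asym_converges X' d' (\<lambda>n. \<phi>' (p n)) (\<psi> P) \<and>
                 (\<exists>!y. asym_converges X' d' (\<lambda>n. \<phi>' (p n)) y))))"
proof -
  interpret conv_sym_metric_space X d
    using assms by (intro conv_sym_metric_space.intro conv_sym_metric_space_axioms.intro)
  show ?thesis
    \<comment> \<open>The two locale introduction rules at the end assemble the hypotheses on the
      target space into the form that \<open>extension_exists\<close> expects.\<close>
    by (intro conjI allI impI ballI equiv_Cauchy_rel tendsto_completion_dist_rep
        asym_metric_completion convergence_symmetric_completion complete_completion
        distance_preserving_embed dense_embed extension_exists
        conv_sym_metric_space.intro conv_sym_metric_space_axioms.intro)
qed

end
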